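(* Let $(G,\zeta)$, $(K,\xi)$ be quandle envelopes on a set $Q$ with a fixed element $e\in Q$. Then the following conditions are equivalent: (i) $\mathcal Q(G,\zeta)\simeq \mathcal Q(K,\xi)$ as quandles. (ii) There is a permutation $\varphi$ of $Q$ such that $e^\varphi=e$, $\zeta^\varphi=\xi$ and $G^\varphi=K$. (iii) There is a group isomorphism $\psi:G\to K$ such that $\zeta^\psi=\xi$ and $(G_e)^{\psi}=K_e$.
   Context: Mappings are applied on the right, as superscripts: $x^{\alpha\beta}=(x^\alpha)^\beta$. For permutations, $\alpha^\varphi=\varphi^{-1}\alpha\varphi$ and $G^\varphi=\varphi^{-1}G\varphi$; for a group isomorphism $\psi$, $\alpha^\psi$ is the image of $\alpha$ and $(G_e)^\psi$ the image of $G_e$. A quandle is a set with a binary operation such that all right translations $R_x:y\mapsto yx$ are automorphisms and $xx=x$ for all $x$. A quandle envelope on $Q$ (with respect to $e$) is a pair $(G,\zeta)$ where $G$ is a transitive permutation group on $Q$, $\zeta\in Z(G_e)$ (the center of the stabilizer of $e$), and $\langle\zeta^G\rangle=G$ (the smallest normal subgroup of $G$ containing $\zeta$ is $G$). The quandle $\mathcal Q(G,\zeta)=(Q,\circ)$ is defined by $x\circ y=x^{\zeta^{\widehat y}}$, where $\widehat y$ is any element of $G$ with $e^{\widehat y}=y$ (the operation does not depend on the choice of $\widehat y$). *)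

theory Defs
  imports "HOL-Algebra.Algebra"
begin

text \<open>
  Permutations of \<open>Q\<close> are elements of \<^term>\<open>BijGroup Q\<close>, whose product is composition of
  functions acting on the left: \<open>\<alpha> \<otimes> \<beta>\<close> is what is written \<open>\<beta>\<alpha>\<close> when mappings act on the
  right. Hence \<open>\<alpha>\<^sup>\<phi> = \<phi>\<^sup>-\<^sup>1\<alpha>\<phi>\<close> for right actions becomes \<open>\<phi> \<otimes> \<alpha> \<otimes> inv \<phi>\<close> here, the
  map sending \<open>x\<close> to \<open>\<phi> (\<alpha> (\<phi>\<^sup>-\<^sup>1 x))\<close>. Subgroups, stabilizers, centers, generated
  subgroups and isomorphisms do not depend on the choice of side.
\<close>

definition perm_conj :: "'a set \<Rightarrow> ('a \<Rightarrow> 'a) \<Rightarrow> ('a \<Rightarrow> 'a) \<Rightarrow> ('a \<Rightarrow> 'a)" where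
  "perm_conj Q \<alpha> \<phi> = \<phi> \<otimes>\<^bsub>BijGroup Q\<^esub> \<alpha> \<otimes>\<^bsub>BijGroup Q\<^esub> inv\<^bsub>BijGroup Q\<^esub> \<phi>"

abbreviation perm_group :: "'a set \<Rightarrow> ('a \<Rightarrow> 'a) set \<Rightarrow> ('a \<Rightarrow> 'a) monoid" where
  "perm_group Q G \<equiv> BijGroup Q\<lparr>carrier := G\<rparr>"

abbreviation point_stabilizer :: "'a set \<Rightarrow> ('a \<Rightarrow> 'a) set \<Rightarrow> 'a \<Rightarrow> ('a \<Rightarrow> 'a) set" where
  "point_stabilizer Q G e \<equiv> stabilizer (perm_group Q G) (\<lambda>g. g) e"

definition group_center :: "('a, 'b) monoid_scheme \<Rightarrow> 'a set" where
  "group_center G = {z \<in> carrier G. \<forall>g\<in>carrier G. z \<otimes>\<^bsub>G\<^esub> g = g \<otimes>\<^bsub>G\<^esub> z}"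

text \<open>\<open>perm_conj Q \<zeta> ` G\<close> is the conjugacy class of \<open>\<zeta>\<close> in \<open>G\<close>.\<close>

locale quandle_envelope =
  fixes Q :: "'a set" and e :: 'a and G :: "('a \<Rightarrow> 'a) set" and \<zeta> :: "'a \<Rightarrow> 'a"
  assumes base_point: "e \<in> Q"
    and permutation_group: "subgroup G (BijGroup Q)"
    and transitive: "transitive_action (perm_group Q G) Q (\<lambda>g. g)"
    and central: "\<zeta> \<in> group_center (perm_group Q (point_stabilizer Q G e))"
    and generating: "generate (BijGroup Q) (perm_conj Q \<zeta> ` G) = G"

definition envelope_op ::
    "'a set \<Rightarrow> 'a \<Rightarrow> ('a \<Rightarrow> 'a) set \<Rightarrow> ('a \<Rightarrow> 'a) \<Rightarrow> 'a \<Rightarrow> 'a \<Rightarrow> 'a" where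
  "envelope_op Q e G \<zeta> x y = perm_conj Q \<zeta> (SOME g. g \<in> G \<and> g e = y) x"

definition quandle :: "'a set \<Rightarrow> ('a \<Rightarrow> 'a \<Rightarrow> 'a) \<Rightarrow> bool" where
  "quandle Q f \<longleftrightarrow>
     (\<forall>x\<in>Q. bij_betw (\<lambda>y. f y x) Q Q \<and> (\<forall>y\<in>Q. \<forall>z\<in>Q. f (f y z) x = f (f y x) (f z x))) \<and>
     (\<forall>x\<in>Q. f x x = x)"

definition quandle_isomorphic ::
    "'a set \<Rightarrow> ('a \<Rightarrow> 'a \<Rightarrow> 'a) \<Rightarrow> 'b set \<Rightarrow> ('b \<Rightarrow> 'b \<Rightarrow> 'b) \<Rightarrow> bool" where
  "quandle_isomorphic Q f R g \<longleftrightarrow>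
     (\<exists>h. bij_betw h Q R \<and> (\<forall>x\<in>Q. \<forall>y\<in>Q. h (f x y) = g (h x) (h y)))"

lemma BijGroup_simps:
  "carrier (BijGroup Q) = Bij Q"
  "f \<in> Bij Q \<Longrightarrow> g \<in> Bij Q \<Longrightarrow> f \<otimes>\<^bsub>BijGroup Q\<^esub> g = compose Q f g"
  by (simp_all add: BijGroup_def)

lemma Bij_apply: "f \<in> Bij Q \<Longrightarrow> x \<in> Q \<Longrightarrow> f x \<in> Q"
  by (auto simp: Bij_def bij_betw_def)

context quandle_envelope
begin

interpretation B: group "BijGroup Q"
  by (rule group_BijGroup)

lemma G_Bij: "g \<in> G \<Longrightarrow> g \<in> Bij Q"
  using subgroup.subset[OF permutation_group] by (auto simp: BijGroup_simps)

lemma mult_apply: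
  "g \<in> G \<Longrightarrow> h \<in> G \<Longrightarrow> x \<in> Q \<Longrightarrow> (g \<otimes>\<^bsub>BijGroup Q\<^esub> h) x = g (h x)"
  by (simp add: BijGroup_simps G_Bij compose_def)

lemma G_inv: "g \<in> G \<Longrightarrow> inv\<^bsub>BijGroup Q\<^esub> g \<in> G"
  by (rule subgroup.m_inv_closed[OF permutation_group])

lemma G_mult: "g \<in> G \<Longrightarrow> h \<in> G \<Longrightarrow> g \<otimes>\<^bsub>BijGroup Q\<^esub> h \<in> G"
  by (rule subgroup.m_closed[OF permutation_group])

lemma G_carrier: "g \<in> G \<Longrightarrow> g \<in> carrier (BijGroup Q)"
  using G_Bij by (simp add: BijGroup_simps)

lemma inv_apply:
  assumes "g \<in> G" "x \<in> Q"
  shows "(inv\<^bsub>BijGroup Q\<^esub> g) (g x) = x" "g ((inv\<^bsub>BijGroup Q\<^esub> g) x) = x"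
proof -
  have "\<one>\<^bsub>BijGroup Q\<^esub> x = x"
    using assms(2) by (simp add: BijGroup_def)
  then have "(inv\<^bsub>BijGroup Q\<^esub> g \<otimes>\<^bsub>BijGroup Q\<^esub> g) x = x" "(g \<otimes>\<^bsub>BijGroup Q\<^esub> inv\<^bsub>BijGroup Q\<^esub> g) x = x"
    using G_carrier[OF assms(1)] by simp_all
  then show "(inv\<^bsub>BijGroup Q\<^esub> g) (g x) = x" "g ((inv\<^bsub>BijGroup Q\<^esub> g) x) = x"
    using mult_apply[OF G_inv[OF assms(1)] assms] mult_apply[OF assms(1) G_inv[OF assms(1)] assms(2)]
    by simp_all
qed

lemma zeta: "\<zeta> \<in> G" "\<zeta> e = e"
  using central by (auto simp: group_center_def stabilizer_def)

lemma zeta_commute: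
  "h \<in> G \<Longrightarrow> h e = e \<Longrightarrow> \<zeta> \<otimes>\<^bsub>BijGroup Q\<^esub> h = h \<otimes>\<^bsub>BijGroup Q\<^esub> \<zeta>"
  using central by (auto simp: group_center_def stabilizer_def)

lemma perm_conj_in: "g \<in> G \<Longrightarrow> perm_conj Q \<zeta> g \<in> G"
  by (simp add: perm_conj_def G_mult G_inv zeta)

lemma perm_conj_apply:
  "g \<in> G \<Longrightarrow> x \<in> Q \<Longrightarrow> perm_conj Q \<zeta> g x = g (\<zeta> ((inv\<^bsub>BijGroup Q\<^esub> g) x))"
  by (simp add: perm_conj_def mult_apply G_mult G_inv zeta Bij_apply G_Bij)

lemma perm_conj_cong:
  assumes g: "g \<in> G" and h: "h \<in> G" and eq: "g e = h e"
  shows "perm_conj Q \<zeta> g = perm_conj Q \<zeta> h"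
proof -
  let ?k = "inv\<^bsub>BijGroup Q\<^esub> g \<otimes>\<^bsub>BijGroup Q\<^esub> h"
  have k: "?k \<in> G" "?k e = e"
    using g h eq base_point inv_apply(1)[OF g base_point] by (simp_all add: G_mult G_inv mult_apply)
  have hk: "h = g \<otimes>\<^bsub>BijGroup Q\<^esub> ?k"
    using g h G_carrier by (simp add: B.m_assoc[symmetric])
  have c: "g \<in> carrier (BijGroup Q)" "?k \<in> carrier (BijGroup Q)" "\<zeta> \<in> carrier (BijGroup Q)"
    using g k zeta G_carrier by auto
  have "perm_conj Q \<zeta> (g \<otimes>\<^bsub>BijGroup Q\<^esub> k) = perm_conj Q \<zeta> g"
    if kk: "k \<in> carrier (BijGroup Q)" "\<zeta> \<otimes>\<^bsub>BijGroup Q\<^esub> k = k \<otimes>\<^bsub>BijGroup Q\<^esub> \<zeta>" for k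
  proof -
    have "perm_conj Q \<zeta> (g \<otimes>\<^bsub>BijGroup Q\<^esub> k) =
        g \<otimes>\<^bsub>BijGroup Q\<^esub> (k \<otimes>\<^bsub>BijGroup Q\<^esub> \<zeta>) \<otimes>\<^bsub>BijGroup Q\<^esub> inv\<^bsub>BijGroup Q\<^esub> k \<otimes>\<^bsub>BijGroup Q\<^esub> inv\<^bsub>BijGroup Q\<^esub> g"
      using c kk(1) by (simp add: perm_conj_def B.inv_mult_group B.m_assoc)
    also have "\<dots> = perm_conj Q \<zeta> g"
      using c kk(1) by (simp add: perm_conj_def B.m_assoc kk(2)[symmetric])
    finally show ?thesis .
  qed
  from this[OF c(2) zeta_commute[OF k]] show ?thesis
    using hk by simp
qed

lemma transitiveE:
  assumes "x \<in> Q" "y \<in> Q" obtains g where "g \<in> G" "g x = y"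
  using transitive_action.unique_orbit[OF transitive assms] by auto

text \<open>The operation does not depend on the choice of the permutation taking \<open>e\<close> to \<open>y\<close>.\<close>

lemma envelope_op_eq:
  assumes "g \<in> G"
  shows "envelope_op Q e G \<zeta> x (g e) = perm_conj Q \<zeta> g x"
proof -
  have "(SOME h. h \<in> G \<and> h e = g e) \<in> G \<and> (SOME h. h \<in> G \<and> h e = g e) e = g e"
    by (rule someI[where P = "\<lambda>h. h \<in> G \<and> h e = g e"]) (use assms in simp)
  then show ?thesis
    using perm_conj_cong[OF _ assms] by (simp add: envelope_op_def)
qed

lemma envelope_op_automorphism:
  assumes g: "g \<in> G" and x: "x \<in> Q" and y: "y \<in> Q"
  shows "g (envelope_op Q e G \<zeta> x y) = envelope_op Q e G \<zeta> (g x) (g y)"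
proof -
  obtain h where h: "h \<in> G" "h e = y"
    using transitiveE base_point y by metis
  have gh: "g \<otimes>\<^bsub>BijGroup Q\<^esub> h \<in> G" "(g \<otimes>\<^bsub>BijGroup Q\<^esub> h) e = g y"
    using g h base_point by (simp_all add: G_mult mult_apply)
  have gx: "g x \<in> Q" using g x by (simp add: Bij_apply G_Bij)
  have iv: "(inv\<^bsub>BijGroup Q\<^esub> (g \<otimes>\<^bsub>BijGroup Q\<^esub> h)) (g x) = (inv\<^bsub>BijGroup Q\<^esub> h) x"
    using g h gx x by (simp add: B.inv_mult_group G_carrier mult_apply G_inv inv_apply)
  have q: "\<zeta> ((inv\<^bsub>BijGroup Q\<^esub> h) x) \<in> Q"
    using h x by (simp add: Bij_apply G_Bij G_inv zeta)
  have "envelope_op Q e G \<zeta> (g x) (g y) = g (h (\<zeta> ((inv\<^bsub>BijGroup Q\<^esub> h) x)))"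
    using envelope_op_eq[OF gh(1), of "g x"] gh gx iv q g h
    by (simp add: perm_conj_apply mult_apply)
  then show ?thesis
    using envelope_op_eq[OF h(1), of x] h x by (simp add: perm_conj_apply)
qed

lemma quandle_envelope_op: "quandle Q (envelope_op Q e G \<zeta>)"
  unfolding quandle_def
proof (intro conjI ballI)
  fix x assume x: "x \<in> Q"
  obtain g where g: "g \<in> G" "g e = x"
    using transitiveE base_point x by metis
  have R: "envelope_op Q e G \<zeta> y x = perm_conj Q \<zeta> g y" for y
    using envelope_op_eq[OF g(1)] g by simp
  show "bij_betw (\<lambda>y. envelope_op Q e G \<zeta> y x) Q Q"
    using G_Bij[OF perm_conj_in[OF g(1)]] by (simp add: R Bij_def)
  show "envelope_op Q e G \<zeta> x x = x"
    using g x inv_apply(1)[OF g(1) base_point] by (simp add: R perm_conj_apply zeta)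
  fix y z assume "y \<in> Q" "z \<in> Q"
  then show "envelope_op Q e G \<zeta> (envelope_op Q e G \<zeta> y z) x =
      envelope_op Q e G \<zeta> (envelope_op Q e G \<zeta> y x) (envelope_op Q e G \<zeta> z x)"
    using envelope_op_automorphism[OF perm_conj_in[OF g(1)]] by (simp add: R)
qed

end

text \<open>
  The subgroup generated by the conjugacy class of \<open>\<zeta>\<close> in \<open>G\<close> is the smallest normal subgroup
  of \<open>G\<close> containing \<open>\<zeta>\<close>.
\<close>

lemma generate_conjugates_eq_normal_closure:
  assumes G: "subgroup G (BijGroup Q)" and z: "\<zeta> \<in> G"
  shows "generate (BijGroup Q) (perm_conj Q \<zeta> ` G) = \<Inter>{N. N \<lhd> perm_group Q G \<and> \<zeta> \<in> N}"
proof -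
  interpret B: group "BijGroup Q" by (rule group_BijGroup)
  interpret H: group "perm_group Q G" by (rule B.subgroup_imp_group[OF G])
  let ?C = "perm_conj Q \<zeta> ` G"
  have c: "g \<in> carrier (BijGroup Q)" if "g \<in> G" for g
    using subgroup.mem_carrier[OF G that] .
  have inv: "inv\<^bsub>perm_group Q G\<^esub> g = inv\<^bsub>BijGroup Q\<^esub> g" if "g \<in> G" for g
    using B.m_inv_consistent[OF G that] .
  have CG: "?C \<subseteq> G"
    using z by (auto simp: perm_conj_def intro!: subgroup.m_closed[OF G] subgroup.m_inv_closed[OF G])
  have gen: "generate (BijGroup Q) ?C = generate (perm_group Q G) ?C"
    using B.generate_consistent[OF CG G] by (rule sym)
  have "generate (perm_group Q G) ?C \<lhd> perm_group Q G"
  proof (rule H.normal_generateI)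
    show "?C \<subseteq> carrier (perm_group Q G)" using CG by simp
    fix h g assume h: "h \<in> ?C" and "g \<in> carrier (perm_group Q G)"
    then obtain k where k: "k \<in> G" "h = perm_conj Q \<zeta> k" and g: "g \<in> G" by auto
    have "g \<otimes>\<^bsub>BijGroup Q\<^esub> h \<otimes>\<^bsub>BijGroup Q\<^esub> inv\<^bsub>BijGroup Q\<^esub> g = perm_conj Q \<zeta> (g \<otimes>\<^bsub>BijGroup Q\<^esub> k)"
      using k g z c by (simp add: perm_conj_def B.inv_mult_group B.m_assoc)
    then show "g \<otimes>\<^bsub>perm_group Q G\<^esub> h \<otimes>\<^bsub>perm_group Q G\<^esub> inv\<^bsub>perm_group Q G\<^esub> g \<in> ?C"
      using g k inv subgroup.m_closed[OF G g k(1)] by simp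
  qed
  moreover have "\<zeta> \<in> generate (perm_group Q G) ?C"
  proof (rule generate.incl)
    have "\<zeta> = perm_conj Q \<zeta> \<one>\<^bsub>BijGroup Q\<^esub>"
      using c[OF z] by (simp add: perm_conj_def)
    then show "\<zeta> \<in> ?C" using subgroup.one_closed[OF G] by blast
  qed
  moreover have "generate (perm_group Q G) ?C \<subseteq> N"
    if N: "N \<lhd> perm_group Q G" "\<zeta> \<in> N" for N
  proof (rule H.generate_subgroup_incl)
    show "subgroup N (perm_group Q G)" using N(1) by (rule normal_imp_subgroup)
    show "?C \<subseteq> N"
      using normal.inv_op_closed2[OF N(1) _ N(2)] inv by (auto simp: perm_conj_def)
  qed
  ultimately show ?thesis
    unfolding gen by blast
qed

end

theory Submission
  imports Defs
begin

text \<open>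
  The right translation by \<open>g e\<close> in \<open>envelope_op Q e G \<zeta>\<close> is the conjugate of \<open>\<zeta>\<close> by \<open>g\<close>, so an
  isomorphism fixing \<open>e\<close> conjugates the generating class of \<open>G\<close> onto that of \<open>K\<close>, hence \<open>G\<close> onto
  \<open>K\<close>; as \<open>K\<close> is a transitive group of automorphisms, every isomorphism can be corrected to
  fix \<open>e\<close>. Conjugation by such a permutation is a group isomorphism of the required
  kind. Conversely, identifying \<open>Q\<close> with the cosets of the stabilizers, a group isomorphism \<open>\<psi>\<close>
  induces the quandle isomorphism \<open>g e \<mapsto> \<psi> g e\<close>.
\<close>

section \<open>Conjugation as an automorphism of the symmetric group on \<open>Q\<close>\<close>

lemma Bij_eqI:
  assumes "f \<in> Bij Q" "g \<in> Bij Q" "\<And>x. x \<in> Q \<Longrightarrow> f x = g x"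
  shows "f = g"
  using assms by (auto simp: Bij_def intro: extensionalityI)

lemma Bij_imageE:
  assumes "f \<in> Bij Q" "y \<in> Q" obtains x where "x \<in> Q" "y = f x"
  using assms by (auto simp: Bij_def bij_betw_def)

lemma Bij_eq_iff:
  assumes "f \<in> Bij Q" "x \<in> Q" "y \<in> Q"
  shows "f x = f y \<longleftrightarrow> x = y"
  using assms by (auto simp: Bij_def bij_betw_def dest: inj_onD)

lemma perm_conj_Bij:
  assumes "\<alpha> \<in> Bij Q" "\<phi> \<in> Bij Q"
  shows "perm_conj Q \<alpha> \<phi> \<in> Bij Q"
proof -
  interpret B: group "BijGroup Q" by (rule group_BijGroup)
  have "perm_conj Q \<alpha> \<phi> \<in> carrier (BijGroup Q)"
    using assms unfolding perm_conj_def
    by (intro B.m_closed B.inv_closed) (simp_all add: BijGroup_simps)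
  then show ?thesis by (simp add: BijGroup_simps)
qed

text \<open>At a point of the form \<open>\<phi> x\<close> the inverse inside the conjugate cancels.
  As \<open>\<phi>\<close> maps onto \<open>Q\<close>, these values determine the conjugate.\<close>

lemma perm_conj_image:
  assumes a: "\<alpha> \<in> Bij Q" and p: "\<phi> \<in> Bij Q" and x: "x \<in> Q"
  shows "perm_conj Q \<alpha> \<phi> (\<phi> x) = \<phi> (\<alpha> x)"
proof -
  interpret B: group "BijGroup Q" by (rule group_BijGroup)
  have c: "\<alpha> \<in> carrier (BijGroup Q)" "\<phi> \<in> carrier (BijGroup Q)"
    using a p by (simp_all add: BijGroup_simps)
  have "perm_conj Q \<alpha> \<phi> \<otimes>\<^bsub>BijGroup Q\<^esub> \<phi> = \<phi> \<otimes>\<^bsub>BijGroup Q\<^esub> \<alpha>"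
    using c by (simp add: perm_conj_def B.m_assoc)
  then have "compose Q (perm_conj Q \<alpha> \<phi>) \<phi> = compose Q \<phi> \<alpha>"
    using a p perm_conj_Bij[OF a p] by (simp add: BijGroup_simps)
  then have "compose Q (perm_conj Q \<alpha> \<phi>) \<phi> x = compose Q \<phi> \<alpha> x" by simp
  then show ?thesis using x by (simp add: compose_eq)
qed

text \<open>Replaces a conjugacy equation by an intertwining relation, the form in which a quandle
  homomorphism relates right translations.\<close>

lemma perm_conj_eqI:
  assumes "\<alpha> \<in> Bij Q" "\<phi> \<in> Bij Q" "\<beta> \<in> Bij Q" "\<And>x. x \<in> Q \<Longrightarrow> \<phi> (\<alpha> x) = \<beta> (\<phi> x)"
  shows "perm_conj Q \<alpha> \<phi> = \<beta>"
proof (rule Bij_eqI[OF perm_conj_Bij[OF assms(1,2)] assms(3)])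
  fix y assume "y \<in> Q"
  then obtain x where "x \<in> Q" "y = \<phi> x" using assms(2) by (blast elim: Bij_imageE)
  then show "perm_conj Q \<alpha> \<phi> y = \<beta> y" using assms by (simp add: perm_conj_image)
qed

lemma perm_conj_hom:
  assumes "\<phi> \<in> Bij Q"
  shows "(\<lambda>\<alpha>. perm_conj Q \<alpha> \<phi>) \<in> hom (BijGroup Q) (BijGroup Q)"
proof -
  interpret B: group "BijGroup Q" by (rule group_BijGroup)
  have p: "\<phi> \<in> carrier (BijGroup Q)" using assms by (simp add: BijGroup_simps)
  show ?thesis
  proof (rule homI)
    fix a b assume c: "a \<in> carrier (BijGroup Q)" "b \<in> carrier (BijGroup Q)"
    \<comment> \<open>With products bracketed to the right, the inner factor
      \<open>inv \<phi> \<otimes> \<phi>\<close> does not occur as a subterm, so its cancellation is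
      stated with a trailing factor.\<close>
    have "inv\<^bsub>BijGroup Q\<^esub> \<phi> \<otimes>\<^bsub>BijGroup Q\<^esub> (\<phi> \<otimes>\<^bsub>BijGroup Q\<^esub> z) = z" if "z \<in> carrier (BijGroup Q)" for z
      using p that by (simp add: B.m_assoc[symmetric])
    then show "perm_conj Q (a \<otimes>\<^bsub>BijGroup Q\<^esub> b) \<phi> = perm_conj Q a \<phi> \<otimes>\<^bsub>BijGroup Q\<^esub> perm_conj Q b \<phi>"
      using c p by (simp add: perm_conj_def B.m_assoc)
  qed (use assms in \<open>simp add: BijGroup_simps perm_conj_Bij\<close>)
qed

lemma inj_on_perm_conj:
  assumes "\<phi> \<in> Bij Q"
  shows "inj_on (\<lambda>\<alpha>. perm_conj Q \<alpha> \<phi>) (Bij Q)"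
proof (rule inj_onI)
  fix a b assume a: "a \<in> Bij Q" and b: "b \<in> Bij Q" and eq: "perm_conj Q a \<phi> = perm_conj Q b \<phi>"
  show "a = b"
  proof (rule Bij_eqI[OF a b])
    fix x assume x: "x \<in> Q"
    have "\<phi> (a x) = \<phi> (b x)"
      using perm_conj_image[OF a assms x] perm_conj_image[OF b assms x] eq by simp
    then show "a x = b x"
      using a b x assms by (simp add: Bij_eq_iff Bij_apply)
  qed
qed

section \<open>Right translations and stabilizer cosets in a single envelope\<close>

context quandle_envelope
begin

lemma mem_point_stabilizer: "g \<in> point_stabilizer Q G e \<longleftrightarrow> g \<in> G \<and> g e = e"
  by (auto simp: stabilizer_def)

text \<open>The right translation by \<open>g e\<close> is \<open>\<zeta>\<close> conjugated by
  \<open>g\<close>, and the inverse of \<open>g\<close> cancels against \<open>g x\<close>. By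
  transitivity every pair of points of \<open>Q\<close> can be written as \<open>g x\<close>,
  \<open>g e\<close>.\<close>

lemma envelope_op_translate:
  assumes "g \<in> G" "x \<in> Q"
  shows "envelope_op Q e G \<zeta> (g x) (g e) = g (\<zeta> x)"
  using assms by (simp add: envelope_op_eq perm_conj_apply inv_apply Bij_apply G_Bij)

text \<open>The case where \<open>g\<close> is the identity. It recovers \<open>\<zeta>\<close> from
  the quandle, so an isomorphism fixing \<open>e\<close> must conjugate \<open>\<zeta>\<close> to
  \<open>\<xi>\<close>.\<close>

lemma envelope_op_base:
  assumes "x \<in> Q" shows "envelope_op Q e G \<zeta> x e = \<zeta> x"
  using envelope_op_translate[OF subgroup.one_closed[OF permutation_group] assms] assms base_point
    Bij_apply[OF G_Bij[OF zeta(1)] assms]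
  by (simp add: BijGroup_def)

text \<open>Points of \<open>Q\<close> correspond to left cosets of the stabilizer. The right-hand
  side mentions only products and the stabilizer, so an abstract group isomorphism respecting
  stabilizers can transport it.\<close>

lemma same_value_iff:
  assumes g: "g \<in> G" and h: "h \<in> G"
  shows "g e = h e \<longleftrightarrow> (\<exists>k\<in>point_stabilizer Q G e. h = g \<otimes>\<^bsub>BijGroup Q\<^esub> k)"
proof
  interpret B: group "BijGroup Q" by (rule group_BijGroup)
  assume eq: "g e = h e"
  let ?k = "inv\<^bsub>BijGroup Q\<^esub> g \<otimes>\<^bsub>BijGroup Q\<^esub> h"
  have "?k \<in> G" "?k e = e"
    using g h eq base_point inv_apply(1)[OF g base_point] by (simp_all add: G_mult G_inv mult_apply)
  moreover have "h = g \<otimes>\<^bsub>BijGroup Q\<^esub> ?k"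
    using g h G_carrier by (simp add: B.m_assoc[symmetric])
  ultimately show "\<exists>k\<in>point_stabilizer Q G e. h = g \<otimes>\<^bsub>BijGroup Q\<^esub> k"
    by (intro bexI[of _ ?k]) (simp_all only: mem_point_stabilizer simp_thms)
next
  assume "\<exists>k\<in>point_stabilizer Q G e. h = g \<otimes>\<^bsub>BijGroup Q\<^esub> k"
  then obtain k where "k \<in> point_stabilizer Q G e" "h = g \<otimes>\<^bsub>BijGroup Q\<^esub> k"
    by (rule bexE)
  then show "g e = h e"
    using mult_apply[OF g _ base_point, of k] by (simp add: mem_point_stabilizer)
qed

end

section \<open>From quandle isomorphisms to permutations fixing \<open>e\<close>\<close>

lemma envelope_isomorphism_fixing_base:
  assumes K: "quandle_envelope Q e K \<xi>" and e: "e \<in> Q"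
    and iso: "quandle_isomorphic Q f Q (envelope_op Q e K \<xi>)"
    and closed: "\<And>x y. x \<in> Q \<Longrightarrow> y \<in> Q \<Longrightarrow> f x y \<in> Q"
  obtains \<phi> where "\<phi> \<in> Bij Q" "\<phi> e = e"
    "\<And>x y. x \<in> Q \<Longrightarrow> y \<in> Q \<Longrightarrow> \<phi> (f x y) = envelope_op Q e K \<xi> (\<phi> x) (\<phi> y)"
proof -
  interpret K: quandle_envelope Q e K \<xi> by (rule K)
  obtain h where h: "bij_betw h Q Q"
    and hom: "\<And>x y. x \<in> Q \<Longrightarrow> y \<in> Q \<Longrightarrow> h (f x y) = envelope_op Q e K \<xi> (h x) (h y)"
    using iso unfolding quandle_isomorphic_def by blast
  have hQ: "h x \<in> Q" if "x \<in> Q" for x using h that by (rule bij_betw_apply)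
  obtain k where k: "k \<in> K" "k (h e) = e"
    using K.transitiveE[OF hQ[OF e] e] by metis
  \<comment> \<open>\<open>h\<close> is arbitrary outside \<open>Q\<close>; the restricted
    composition is extensional and so can lie in \<open>Bij Q\<close>. The automorphism
    \<open>k\<close> preserves the homomorphism property.\<close>
  let ?p = "compose Q k h"
  have "bij_betw ?p Q Q"
    using h K.G_Bij[OF k(1)] by (intro bij_betw_compose) (auto simp: Bij_def)
  then have "?p \<in> Bij Q" by (simp add: Bij_def compose_def)
  moreover have "?p e = e" using e k by (simp add: compose_eq)
  moreover have "?p (f x y) = envelope_op Q e K \<xi> (?p x) (?p y)" if "x \<in> Q" "y \<in> Q" for x y
    using that k closed hQ by (simp add: compose_eq hom K.envelope_op_automorphism)
  ultimately show ?thesis by (rule that)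
qed

lemma permutation_of_quandle_isomorphic:
  assumes G: "quandle_envelope Q e G \<zeta>" and K: "quandle_envelope Q e K \<xi>"
    and iso: "quandle_isomorphic Q (envelope_op Q e G \<zeta>) Q (envelope_op Q e K \<xi>)"
  shows "\<exists>\<phi>\<in>Bij Q. \<phi> e = e \<and> perm_conj Q \<zeta> \<phi> = \<xi> \<and> (\<lambda>\<alpha>. perm_conj Q \<alpha> \<phi>) ` G = K"
proof -
  interpret G: quandle_envelope Q e G \<zeta> by (rule G)
  interpret K: quandle_envelope Q e K \<xi> by (rule K)
  note e = G.base_point
  have closed: "envelope_op Q e G \<zeta> x y \<in> Q" if "x \<in> Q" "y \<in> Q" for x y
    using G.quandle_envelope_op that bij_betw_apply[of "\<lambda>x. envelope_op Q e G \<zeta> x y" Q Q x]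
    by (simp add: quandle_def)
  obtain \<phi> where p: "\<phi> \<in> Bij Q" "\<phi> e = e"
    and hom: "\<And>x y. x \<in> Q \<Longrightarrow> y \<in> Q \<Longrightarrow>
      \<phi> (envelope_op Q e G \<zeta> x y) = envelope_op Q e K \<xi> (\<phi> x) (\<phi> y)"
    using envelope_isomorphism_fixing_base[OF K e iso closed] by metis
  let ?c = "\<lambda>\<alpha>. perm_conj Q \<alpha> \<phi>"
  \<comment> \<open>The two conjugates are the right translations by \<open>g e\<close> and by its
    image \<open>\<phi> (g e)\<close>, and a homomorphism intertwines such translations.\<close>
  have conj: "?c (perm_conj Q \<zeta> g) = perm_conj Q \<xi> k" if "g \<in> G" "k \<in> K" "k e = \<phi> (g e)" for g k
  proof (rule perm_conj_eqI)
    fix x assume x: "x \<in> Q"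
    have "\<phi> (envelope_op Q e G \<zeta> x (g e)) = envelope_op Q e K \<xi> (\<phi> x) (k e)"
      using hom[OF x] that e by (simp add: Bij_apply G.G_Bij)
    then show "\<phi> (perm_conj Q \<zeta> g x) = perm_conj Q \<xi> k (\<phi> x)"
      using G.envelope_op_eq[OF that(1)] K.envelope_op_eq[OF that(2)] by simp
  qed (use p that in \<open>simp_all add: G.perm_conj_in G.G_Bij K.perm_conj_in K.G_Bij\<close>)
  have zeta: "?c \<zeta> = \<xi>"
  proof (rule perm_conj_eqI)
    fix x assume x: "x \<in> Q"
    show "\<phi> (\<zeta> x) = \<xi> (\<phi> x)"
      using hom[OF x e] x p by (simp add: G.envelope_op_base K.envelope_op_base Bij_apply)
  qed (use p in \<open>simp_all add: G.zeta G.G_Bij K.zeta K.G_Bij\<close>)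
  \<comment> \<open>Each inclusion needs a partner for a given group element: transitivity of
    \<open>K\<close> supplies \<open>k\<close> with \<open>k e = \<phi> (g e)\<close>, and
    surjectivity of \<open>\<phi>\<close> with transitivity of \<open>G\<close> supplies
    \<open>g\<close>.\<close>
  have "?c ` perm_conj Q \<zeta> ` G = perm_conj Q \<xi> ` K"
  proof (intro equalityI subsetI)
    fix a assume "a \<in> ?c ` perm_conj Q \<zeta> ` G"
    then obtain g where g: "g \<in> G" "a = ?c (perm_conj Q \<zeta> g)" by blast
    have "\<phi> (g e) \<in> Q" using p g e by (simp add: Bij_apply G.G_Bij)
    then obtain k where "k \<in> K" "k e = \<phi> (g e)" using K.transitiveE e by metis
    then show "a \<in> perm_conj Q \<xi> ` K" using conj g by blast
  next
    fix a assume "a \<in> perm_conj Q \<xi> ` K"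
    then obtain k where k: "k \<in> K" "a = perm_conj Q \<xi> k" by blast
    have "k e \<in> Q" using k e by (simp add: Bij_apply K.G_Bij)
    then obtain y where y: "y \<in> Q" "k e = \<phi> y" using p(1) by (blast elim: Bij_imageE)
    then obtain g where g: "g \<in> G" "g e = y" using G.transitiveE e by metis
    then have "a = ?c (perm_conj Q \<zeta> g)" using conj[of g k] k y by simp
    then show "a \<in> ?c ` perm_conj Q \<zeta> ` G" using g by blast
  qed
  \<comment> \<open>A homomorphism commutes with generation, so matching conjugacy classes yield
    matching groups.\<close>
  moreover have "generate (BijGroup Q) (?c ` perm_conj Q \<zeta> ` G) =
      ?c ` generate (BijGroup Q) (perm_conj Q \<zeta> ` G)"
  proof (rule group_hom.generate_img)
    show "group_hom (BijGroup Q) (BijGroup Q) ?c"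
      using perm_conj_hom[OF p(1)] group_BijGroup
      by (simp add: group_hom_def group_hom_axioms_def)
    show "perm_conj Q \<zeta> ` G \<subseteq> carrier (BijGroup Q)"
      using G.perm_conj_in G.G_carrier by blast
  qed
  ultimately have "?c ` G = K"
    using G.generating K.generating by simp
  then show ?thesis using p zeta by blast
qed

section \<open>Passage to abstract group isomorphisms and back to quandles\<close>

lemma group_iso_of_permutation:
  assumes G: "quandle_envelope Q e G \<zeta>" and K: "quandle_envelope Q e K \<xi>"
    and p: "\<phi> \<in> Bij Q" "\<phi> e = e" and img: "(\<lambda>\<alpha>. perm_conj Q \<alpha> \<phi>) ` G = K"
  shows "(\<lambda>\<alpha>. perm_conj Q \<alpha> \<phi>) \<in> iso (perm_group Q G) (perm_group Q K)"
    and "(\<lambda>\<alpha>. perm_conj Q \<alpha> \<phi>) ` point_stabilizer Q G e = point_stabilizer Q K e"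
proof -
  interpret G: quandle_envelope Q e G \<zeta> by (rule G)
  interpret K: quandle_envelope Q e K \<xi> by (rule K)
  let ?c = "\<lambda>\<alpha>. perm_conj Q \<alpha> \<phi>"
  have "?c \<in> hom (perm_group Q G) (perm_group Q K)"
    using perm_conj_hom[OF p(1)] img G.G_carrier by (auto simp: hom_def)
  moreover have "bij_betw ?c G K"
    using inj_on_subset[OF inj_on_perm_conj[OF p(1)]] G.G_Bij img by (auto simp: bij_betw_def)
  ultimately show "?c \<in> iso (perm_group Q G) (perm_group Q K)"
    by (simp add: iso_def)
  \<comment> \<open>Since \<open>\<phi> e = e\<close>, the conjugate sends \<open>e\<close> to
    \<open>\<phi> (g e)\<close>; injectivity of \<open>\<phi>\<close> then gives the
    equivalence.\<close>
  have "?c g e = e \<longleftrightarrow> g e = e" if "g \<in> G" for g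
    using perm_conj_image[OF G.G_Bij[OF that] p(1) G.base_point] p
      Bij_eq_iff[OF p(1), of "g e" e] Bij_apply[OF G.G_Bij[OF that] G.base_point] G.base_point
    by simp
  then show "?c ` point_stabilizer Q G e = point_stabilizer Q K e"
    using img by (auto simp: stabilizer_def)
qed

lemma quandle_isomorphic_of_group_iso:
  assumes G: "quandle_envelope Q e G \<zeta>" and K: "quandle_envelope Q e K \<xi>"
    and iso: "\<psi> \<in> iso (perm_group Q G) (perm_group Q K)"
    and zeta: "\<psi> \<zeta> = \<xi>"
    and stab: "\<psi> ` point_stabilizer Q G e = point_stabilizer Q K e"
  shows "quandle_isomorphic Q (envelope_op Q e G \<zeta>) Q (envelope_op Q e K \<xi>)"
proof -
  interpret G: quandle_envelope Q e G \<zeta> by (rule G)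
  interpret K: quandle_envelope Q e K \<xi> by (rule K)
  note e = G.base_point
  have bij: "bij_betw \<psi> G K" using iso by (simp add: iso_def)
  have psi: "\<psi> g \<in> K" if "g \<in> G" for g using bij that by (rule bij_betw_apply)
  have mult: "\<psi> (g \<otimes>\<^bsub>BijGroup Q\<^esub> h) = \<psi> g \<otimes>\<^bsub>BijGroup Q\<^esub> \<psi> h" if "g \<in> G" "h \<in> G" for g h
    using iso that by (simp add: iso_def hom_def)
  \<comment> \<open>Read from left to right this makes \<open>f\<close> below well defined; from
    right to left it makes \<open>f\<close> injective.\<close>
  have same: "g e = h e \<longleftrightarrow> \<psi> g e = \<psi> h e" if g: "g \<in> G" and h: "h \<in> G" for g h
  proof -
    have "h = g \<otimes>\<^bsub>BijGroup Q\<^esub> k \<longleftrightarrow> \<psi> h = \<psi> g \<otimes>\<^bsub>BijGroup Q\<^esub> \<psi> k"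
      if "k \<in> point_stabilizer Q G e" for k
    proof -
      have k: "k \<in> G" using that by (simp add: G.mem_point_stabilizer)
      show ?thesis
        using inj_on_eq_iff[OF bij_betw_imp_inj_on[OF bij] h G.G_mult[OF g k]] mult[OF g k] by simp
    qed
    then show ?thesis
      unfolding G.same_value_iff[OF g h] K.same_value_iff[OF psi[OF g] psi[OF h]] stab[symmetric]
      by blast
  qed
  define f where "f x = \<psi> (SOME g. g \<in> G \<and> g e = x) e" for x
  have f: "f (g e) = \<psi> g e" if "g \<in> G" for g
  proof -
    have "(SOME h. h \<in> G \<and> h e = g e) \<in> G \<and> (SOME h. h \<in> G \<and> h e = g e) e = g e"
      by (rule someI[where P = "\<lambda>h. h \<in> G \<and> h e = g e"]) (use that in simp)
    then show ?thesis using same that unfolding f_def by blast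
  qed
  have "bij_betw f Q Q"
  proof (rule bij_betw_imageI)
    show "inj_on f Q"
    proof (rule inj_onI)
      fix x y assume "x \<in> Q" "y \<in> Q" and eq: "f x = f y"
      then obtain g h where "g \<in> G" "g e = x" "h \<in> G" "h e = y" using G.transitiveE e by metis
      then show "x = y" using eq f same by metis
    qed
    show "f ` Q = Q"
    proof (intro equalityI subsetI)
      fix y assume "y \<in> f ` Q"
      then obtain x where "x \<in> Q" "y = f x" by blast
      moreover then obtain g where "g \<in> G" "g e = x" using G.transitiveE e by metis
      ultimately show "y \<in> Q" using f psi K.G_Bij Bij_apply e by metis
    next
      \<comment> \<open>Surjectivity combines transitivity of \<open>K\<close> with surjectivity of
        \<open>\<psi>\<close>.\<close>
      fix y assume "y \<in> Q"
      then obtain k where "k \<in> K" "k e = y" using G.base_point K.transitiveE by metis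
      moreover then obtain g where "g \<in> G" "\<psi> g = k"
        using bij by (auto simp: bij_betw_def)
      ultimately show "y \<in> f ` Q" using f[of g] G.G_Bij[of g] Bij_apply[of g Q e] e
        by (metis image_eqI)
    qed
  qed
  moreover have "f (envelope_op Q e G \<zeta> x y) = envelope_op Q e K \<xi> (f x) (f y)"
    if x: "x \<in> Q" and y: "y \<in> Q" for x y
  proof -
    \<comment> \<open>With \<open>y = h e\<close> and \<open>x = h (g e)\<close>, the quandle
      product is the value at \<open>e\<close> of the word
      \<open>h \<otimes> (\<zeta> \<otimes> g)\<close>, which \<open>\<psi>\<close> maps factor by
      factor.\<close>
    obtain h where h: "h \<in> G" "h e = y" using G.transitiveE e y by metis
    obtain z where z: "z \<in> Q" "x = h z" using x G.G_Bij[OF h(1)] by (blast elim: Bij_imageE)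
    obtain g where g: "g \<in> G" "g e = z" using G.transitiveE e z(1) by metis
    have xg: "x = (h \<otimes>\<^bsub>BijGroup Q\<^esub> g) e"
      using g h z e by (simp add: G.mult_apply)
    have ge: "\<psi> g e \<in> Q" using psi[OF g(1)] e by (simp add: Bij_apply K.G_Bij)
    have "envelope_op Q e G \<zeta> x y = h (\<zeta> (g e))"
      using G.envelope_op_translate[OF h(1) z(1)] h g z by simp
    also have "\<dots> = (h \<otimes>\<^bsub>BijGroup Q\<^esub> (\<zeta> \<otimes>\<^bsub>BijGroup Q\<^esub> g)) e"
      using h g e G.zeta by (simp add: G.mult_apply G.G_mult)
    finally have "f (envelope_op Q e G \<zeta> x y) = \<psi> (h \<otimes>\<^bsub>BijGroup Q\<^esub> (\<zeta> \<otimes>\<^bsub>BijGroup Q\<^esub> g)) e"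
      using f h g G.zeta by (simp add: G.G_mult)
    also have "\<dots> = \<psi> h (\<xi> (\<psi> g e))"
      using h g G.zeta e psi K.zeta by (simp add: mult zeta G.G_mult K.G_mult K.mult_apply)
    also have "\<dots> = envelope_op Q e K \<xi> (\<psi> h (\<psi> g e)) (\<psi> h e)"
      using K.envelope_op_translate[OF psi[OF h(1)] ge] by simp
    also have "\<dots> = envelope_op Q e K \<xi> (f x) (f y)"
      using f[OF h(1)] f[OF G.G_mult[OF h(1) g(1)]] h g psi e xg
      by (simp add: mult K.mult_apply)
    finally show ?thesis .
  qed
  ultimately show ?thesis unfolding quandle_isomorphic_def by blast
qed

theorem theorem5p6:
  fixes Q :: "'a set" and e :: 'a
    and G K :: "('a \<Rightarrow> 'a) set" and \<zeta> \<xi> :: "'a \<Rightarrow> 'a"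
  assumes "e \<in> Q"
    and "quandle_envelope Q e G \<zeta>"
    and "quandle_envelope Q e K \<xi>"
  shows "(quandle_isomorphic Q (envelope_op Q e G \<zeta>) Q (envelope_op Q e K \<xi>) \<longleftrightarrow>
           (\<exists>\<phi>\<in>Bij Q. \<phi> e = e \<and> perm_conj Q \<zeta> \<phi> = \<xi> \<and> (\<lambda>\<alpha>. perm_conj Q \<alpha> \<phi>) ` G = K))
       \<and> ((\<exists>\<phi>\<in>Bij Q. \<phi> e = e \<and> perm_conj Q \<zeta> \<phi> = \<xi> \<and> (\<lambda>\<alpha>. perm_conj Q \<alpha> \<phi>) ` G = K) \<longleftrightarrow>
           (\<exists>\<psi>\<in>iso (perm_group Q G) (perm_group Q K).
              \<psi> \<zeta> = \<xi> \<and> \<psi> ` point_stabilizer Q G e = point_stabilizer Q K e))"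
proof -
  note G = assms(2) and K = assms(3)
  let ?i = "quandle_isomorphic Q (envelope_op Q e G \<zeta>) Q (envelope_op Q e K \<xi>)"
  let ?ii = "\<exists>\<phi>\<in>Bij Q. \<phi> e = e \<and> perm_conj Q \<zeta> \<phi> = \<xi> \<and> (\<lambda>\<alpha>. perm_conj Q \<alpha> \<phi>) ` G = K"
  let ?iii = "\<exists>\<psi>\<in>iso (perm_group Q G) (perm_group Q K).
      \<psi> \<zeta> = \<xi> \<and> \<psi> ` point_stabilizer Q G e = point_stabilizer Q K e"
  \<comment> \<open>Three implications in a cycle give both equivalences.\<close>
  have "?i \<Longrightarrow> ?ii"
    by (rule permutation_of_quandle_isomorphic[OF G K])
  moreover have ?iii if ii: ?ii
  proof -
    obtain \<phi> where "\<phi> \<in> Bij Q" "\<phi> e = e" "perm_conj Q \<zeta> \<phi> = \<xi>" "(\<lambda>\<alpha>. perm_conj Q \<alpha> \<phi>) ` G = K"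
      using ii by blast
    then show ?thesis
      using group_iso_of_permutation[OF G K] by (intro bexI[of _ "\<lambda>\<alpha>. perm_conj Q \<alpha> \<phi>"]) simp_all
  qed
  moreover have "?iii \<Longrightarrow> ?i"
    using quandle_isomorphic_of_group_iso[OF G K] by blast
  ultimately show ?thesis by blast
qed

end
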